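(* Let $\mathbb{X},\mathbb{Y}$ be finite-dimensional real inner product spaces, let $\mathcal{K}\subset\mathbb{Y}$ be a closed convex cone, and let $f:\mathbb{X}\to\mathbb{R}$ and $g:\mathbb{X}\to\mathbb{Y}$ be twice continuously differentiable. Consider the conic projection equations in $(x,\lambda)\in\mathbb{X}\times\mathbb{Y}$: $$\text{(E)}\qquad \nabla f(x)-(Dg(x))^*\Pi_{\mathcal{K}^*}(\lambda)=0,\qquad g(x)-\Pi_{\mathcal{K}^*}(\lambda)+\lambda=0,$$ and the KKT conditions in $(x,\sigma)\in\mathbb{X}\times\mathbb{Y}$ of the problem $\min f(x)$ s.t. $g(x)\in\mathcal{K}$: $$\text{(KKT)}\qquad \nabla f(x)-(Dg(x))^*\sigma=0,\quad \langle\sigma,g(x)\rangle=0,\quad g(x)\in\mathcal{K},\quad \sigma\in\mathcal{K}^*.$$ If $(x,\lambda)$ solves (E), then $(x,\Pi_{\mathcal{K}^*}(\lambda))$ satisfies (KKT). Conversely, if $(x,\sigma)$ satisfies (KKT), then $(x,\lambda)$ solves (E), where $\lambda:=\sigma-g(x)$.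
   Context: $\mathcal{K}^*=\{y\in\mathbb{Y}:\langle y,z\rangle\ge0\ \forall z\in\mathcal{K}\}$ is the dual cone. $\Pi_{\mathcal{K}^*}$ is the metric projection onto $\mathcal{K}^*$, $Dg(x)$ is the differential of $g$ at $x$, and $(Dg(x))^*$ its adjoint. *)

theory Defs
  imports "HOL-Analysis.Analysis"
begin

text \<open>The second derivative is taken of the differential as a map into the normed space of
  bounded linear maps.\<close>

definition twice_continuously_differentiable ::
    "('a::real_normed_vector \<Rightarrow> 'b::real_normed_vector) \<Rightarrow> bool" where
  "twice_continuously_differentiable f \<longleftrightarrow>
     (\<exists>(f' :: 'a \<Rightarrow> 'a \<Rightarrow>\<^sub>L 'b) (f'' :: 'a \<Rightarrow> 'a \<Rightarrow>\<^sub>L 'a \<Rightarrow>\<^sub>L 'b).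
        (\<forall>x. (f has_derivative blinfun_apply (f' x)) (at x)) \<and>
        (\<forall>x. (f' has_derivative blinfun_apply (f'' x)) (at x)) \<and>
        continuous_on UNIV f'')"

definition gradient :: "('a::real_inner \<Rightarrow> real) \<Rightarrow> 'a \<Rightarrow> 'a" where
  "gradient f x = (THE D. GDERIV f x :> D)"

lemma gradient_eq:
  assumes "GDERIV f x :> D"
  shows "gradient f x = D"
  unfolding gradient_def
proof (rule the_equality)
  show "GDERIV f x :> D" by (rule assms)
next
  fix E assume "GDERIV f x :> E"
  then have "(\<lambda>h. inner h E) = (\<lambda>h. inner h D)"
    using assms unfolding gderiv_def by (rule has_derivative_unique)
  then have "\<forall>h. inner h E = inner h D"
    by (rule fun_cong[THEN allI])
  then show "E = D"
    by (simp only: vector_eq_ldot)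
qed

definition dual_cone :: "'b::real_inner set \<Rightarrow> 'b set" where
  "dual_cone K = {y. \<forall>z\<in>K. 0 \<le> inner y z}"

lemma closed_dual_cone: "closed (dual_cone K)"
proof -
  have "dual_cone K = (\<Inter>z\<in>K. {y. 0 \<le> inner y z})"
    by (auto simp: dual_cone_def)
  then show ?thesis
    by (auto intro!: closed_INT closed_Collect_le continuous_intros)
qed

lemma convex_cone_dual_cone: "convex_cone (dual_cone K)"
  unfolding convex_cone_iff dual_cone_def by (auto simp: inner_add_left)

definition conic_projection_equations ::
    "('a::euclidean_space \<Rightarrow> real) \<Rightarrow> ('a \<Rightarrow> 'b::euclidean_space) \<Rightarrow> 'b set \<Rightarrow> 'a \<Rightarrow> 'b \<Rightarrow> bool" where
  "conic_projection_equations f g K x l \<longleftrightarrow>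
     gradient f x - adjoint (frechet_derivative g (at x)) (closest_point (dual_cone K) l) = 0 \<and>
     g x - closest_point (dual_cone K) l + l = 0"

definition kkt_conditions ::
    "('a::euclidean_space \<Rightarrow> real) \<Rightarrow> ('a \<Rightarrow> 'b::euclidean_space) \<Rightarrow> 'b set \<Rightarrow> 'a \<Rightarrow> 'b \<Rightarrow> bool" where
  "kkt_conditions f g K x \<sigma> \<longleftrightarrow>
     gradient f x - adjoint (frechet_derivative g (at x)) \<sigma> = 0 \<and>
     inner \<sigma> (g x) = 0 \<and> g x \<in> K \<and> \<sigma> \<in> dual_cone K"

end

theory Submission
  imports Defs
begin

text \<open>The projection \<open>p\<close> of \<open>a\<close> onto a closed convex cone \<open>C\<close> is characterised by
  \<open>p \<in> C\<close>, \<open>p - a \<in> C*\<close> and orthogonality of \<open>p\<close> and \<open>p - a\<close>. Applied to \<open>C = K*\<close>,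
  with \<open>K** = K\<close>, it says that \<open>g(x) = p - \<lambda>\<close> for the projection \<open>p\<close> of \<open>\<lambda>\<close> exactly when
  \<open>p \<in> K*\<close>, \<open>g(x) \<in> K\<close> and \<open>p\<close> is orthogonal to \<open>g(x)\<close>, which is the complementarity
  part of KKT.\<close>

lemma closest_point_convex_cone_iff:
  fixes C :: "'b::euclidean_space set"
  assumes "closed C" and "convex_cone C"
  shows "closest_point C a = p \<longleftrightarrow> p \<in> C \<and> p - a \<in> dual_cone C \<and> inner p (p - a) = 0"
proof
  assume p: "closest_point C a = p"
  have C: "convex C" "C \<noteq> {}"
    using \<open>convex_cone C\<close> by (auto simp: convex_cone_def)
  have add: "x + y \<in> C" if "x \<in> C" "y \<in> C" for x y
    using that \<open>convex_cone C\<close> by (auto simp: convex_cone_iff)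
  have scale: "c *\<^sub>R x \<in> C" if "x \<in> C" "0 \<le> c" for x c
    using that \<open>convex_cone C\<close> by (auto simp: convex_cone_iff)
  have pC: "p \<in> C"
    using closest_point_in_set[OF \<open>closed C\<close> C(2)] p by blast
  have var: "0 \<le> inner (p - a) (x - p)" if "x \<in> C" for x
    using closest_point_dot[OF C(1) \<open>closed C\<close> that, of a] p
    by (simp add: inner_diff_left)
  \<comment> \<open>The variational inequality is tested at \<open>p + z\<close>, which stays in the
    cone.\<close>
  have "0 \<le> inner (p - a) z" if "z \<in> C" for z
    using var[OF add[OF pC that]] by simp
  \<comment> \<open>Testing at \<open>0\<close> and at \<open>2 *\<^sub>R p\<close> bounds the
    product from both sides.\<close>
  moreover have "inner p (p - a) = 0"
    using var[OF scale[OF pC, of 0]] var[OF scale[OF pC, of 2]]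
    by (simp add: scaleR_2 inner_commute)
  ultimately show "p \<in> C \<and> p - a \<in> dual_cone C \<and> inner p (p - a) = 0"
    using pC by (simp add: dual_cone_def)
next
  assume p: "p \<in> C \<and> p - a \<in> dual_cone C \<and> inner p (p - a) = 0"
  have "dist a p \<le> dist a z" if "z \<in> C" for z
  proof -
    have "0 \<le> inner (p - a) (z - p)"
      using p that by (simp add: dual_cone_def inner_diff_right inner_commute[of "p - a" p])
    \<comment> \<open>Split \<open>z - a\<close> as \<open>(p - a) + (z - p)\<close>; the cross term
      is nonnegative by the preceding step.\<close>
    moreover have "(norm (z - a))\<^sup>2 = (norm (p - a))\<^sup>2 + (norm (z - p))\<^sup>2 + 2 * inner (p - a) (z - p)"
      by (simp add: power2_norm_eq_inner inner_diff_left inner_diff_right inner_commute)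
    ultimately have "(norm (p - a))\<^sup>2 \<le> (norm (z - a))\<^sup>2"
      by simp
    then show ?thesis
      by (simp add: dist_norm norm_minus_commute)
  qed
  then show "closest_point C a = p"
    using closest_point_unique[of C p a] assms p by (auto simp: convex_cone_def)
qed

text \<open>The bipolar theorem, by projection: a point of the bidual coincides with its projection
  onto \<open>K\<close>.\<close>

lemma dual_cone_dual_cone:
  fixes K :: "'b::euclidean_space set"
  assumes "closed K" and "convex_cone K"
  shows "dual_cone (dual_cone K) = K"
proof
  show "K \<subseteq> dual_cone (dual_cone K)"
    by (auto simp: dual_cone_def inner_commute)
  show "dual_cone (dual_cone K) \<subseteq> K"
  proof
    fix b assume b: "b \<in> dual_cone (dual_cone K)"
    obtain p where p: "p \<in> K" "p - b \<in> dual_cone K" "inner p (p - b) = 0"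
      using closest_point_convex_cone_iff[OF assms] by blast
    \<comment> \<open>Since \<open>p\<close> is orthogonal to \<open>p - b\<close>, this product is
      minus the squared norm of \<open>p - b\<close>, which must therefore vanish.\<close>
    have "0 \<le> inner b (p - b)"
      using b p(2) by (simp add: dual_cone_def)
    then have "inner (p - b) (p - b) \<le> 0"
      using p(3) by (simp add: inner_diff_left)
    then have "p = b"
      by (simp flip: power2_norm_eq_inner)
    with p(1) show "b \<in> K" by simp
  qed
qed

lemma closest_point_dual_cone_iff:
  fixes K :: "'b::euclidean_space set"
  assumes "closed K" and "convex_cone K"
  shows "closest_point (dual_cone K) a = p \<longleftrightarrow>
    p \<in> dual_cone K \<and> p - a \<in> K \<and> inner p (p - a) = 0"
  using closest_point_convex_cone_iff[OF closed_dual_cone convex_cone_dual_cone, of K a p]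
  by (simp add: dual_cone_dual_cone[OF assms])

theorem theorem3p1:
  fixes f :: "'a::euclidean_space \<Rightarrow> real"
    and g :: "'a \<Rightarrow> 'b::euclidean_space"
    and K :: "'b set"
  assumes "closed K" and "convex_cone K"
    and "twice_continuously_differentiable f"
    and "twice_continuously_differentiable g"
  shows "(\<forall>x l. conic_projection_equations f g K x l \<longrightarrow>
             kkt_conditions f g K x (closest_point (dual_cone K) l)) \<and>
         (\<forall>x \<sigma>. kkt_conditions f g K x \<sigma> \<longrightarrow>
             conic_projection_equations f g K x (\<sigma> - g x))"
proof (intro conjI allI impI)
  fix x l
  assume E: "conic_projection_equations f g K x l"
  define p where "p = closest_point (dual_cone K) l"
  have "g x = p - l"
    using E by (simp add: conic_projection_equations_def eq_diff_eq add_diff_eq diff_add_eq flip: p_def)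
  moreover have "p \<in> dual_cone K \<and> p - l \<in> K \<and> inner p (p - l) = 0"
    using closest_point_dual_cone_iff[OF assms(1,2)] p_def by blast
  ultimately show "kkt_conditions f g K x (closest_point (dual_cone K) l)"
    using E by (simp add: kkt_conditions_def conic_projection_equations_def flip: p_def)
next
  fix x \<sigma>
  assume kkt: "kkt_conditions f g K x \<sigma>"
  \<comment> \<open>For \<open>a = \<sigma> - g x\<close> the residual \<open>\<sigma> - a\<close>
    is \<open>g x\<close>, so KKT supplies the three conditions that make \<open>\<sigma>\<close>
    the projection.\<close>
  then have "closest_point (dual_cone K) (\<sigma> - g x) = \<sigma>"
    by (simp add: closest_point_dual_cone_iff[OF assms(1,2)] kkt_conditions_def)
  with kkt show "conic_projection_equations f g K x (\<sigma> - g x)"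
    by (simp add: kkt_conditions_def conic_projection_equations_def)
qed

end
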